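(* Let $S$ be a finite non-empty set, $p:2^S\to\mathbb{Z}\cup\{-\infty\}$ a supermodular function with $p(\emptyset)=0$ and $p(S)$ finite, and $B=\{x\in\mathbb{R}^S:\widetilde x(S)=p(S),\ \widetilde x(Z)\ge p(Z)\ \forall Z\subseteq S\}$. Let $\{S_1,\dots,S_q\}$, $C_1\subset\cdots\subset C_q=S$, $\beta_1>\cdots>\beta_q$ be the canonical partition, chain and essential value-sequence (defined below). For each $i$ let $p_i(X)=p(X\cup C_{i-1})-p(C_{i-1})$ ($X\subseteq S_i$), $r_i=p_i(S_i)-(\beta_i-1)|S_i|$, and let $\mathcal{B}_i$ be the family of $r_i$-element subsets $L\subseteq S_i$ with $|L\cap X|\ge p_i(X)-(\beta_i-1)|X|$ for all $X\subseteq S_i$; let $M^*$ be the direct sum of the matroids on $S_i$ with basis families $\mathcal{B}_i$ (these families are basis families of matroids), and let $\Delta^*\in\mathbb{Z}^S$ be given by $\Delta^*(s)=\beta_i-1$ for $s\in S_i$. Then an element $m\in B\cap\mathbb{Z}^S$ is decreasingly minimal in $B\cap\mathbb{Z}^S$ if and only if $m=\chi_L+\Delta^*$ for some basis $L$ of $M^*$. Consequently, the set of decreasingly minimal elements of $B\cap\mathbb{Z}^S$ is the set of integral points of the translate by $\Delta^*$ of the base-polyhedron of the matroid $M^*$.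
   Context: $\widetilde x(Z)=\sum_{s\in Z}x(s)$; $\chi_L$ is the characteristic vector of $L$. Canonical partition: $C_0=\emptyset$; for $j=1,2,\dots$ while $C_{j-1}\ne S$: $p'_{j-1}(X)=p(X\cup C_{j-1})-p(C_{j-1})$ for $X\subseteq S-C_{j-1}$; $\beta_j=\max\{\lceil p'_{j-1}(X)/|X|\rceil:\emptyset\ne X\subseteq S-C_{j-1}\}$; $h_j(X)=p'_{j-1}(X)-(\beta_j-1)|X|$; $S_j$ is the intersection of all maximizers of $h_j$ over subsets of $S-C_{j-1}$; $C_j=C_{j-1}\cup S_j$; stop with $q=j$ when $C_j=S$. An element $m$ of a set $Q$ of vectors is decreasingly minimal if, after sorting components in decreasing order, it is lexicographically smaller than or equal to every $y\in Q$ sorted likewise. The base-polyhedron of a matroid is the convex hull of the characteristic vectors of its bases. *)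

theory Defs
  imports "HOL-Analysis.Analysis"
begin

text \<open>The finite non-empty ground set \<open>S\<close> is the universe of a type \<open>'s::finite\<close>, and
  \<open>\<real>\<^sup>S\<close> is \<open>real ^ 's\<close>. Set functions with values in \<open>\<int> \<union> {-\<infinity>}\<close> are \<open>ereal\<close>-valued.\<close>

definition int_or_minf_valued :: "('s set \<Rightarrow> ereal) \<Rightarrow> bool" where
  "int_or_minf_valued p \<longleftrightarrow> (\<forall>X. p X = -\<infinity> \<or> (\<exists>k::int. p X = ereal (of_int k)))"

definition supermodular :: "('s set \<Rightarrow> ereal) \<Rightarrow> bool" where
  "supermodular p \<longleftrightarrow> (\<forall>X Y. p X + p Y \<le> p (X \<inter> Y) + p (X \<union> Y))"

definition base_polyhedron :: "('s::finite set \<Rightarrow> ereal) \<Rightarrow> (real ^ 's) set" where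
  "base_polyhedron p =
     {x. ereal (\<Sum>s\<in>UNIV. x $ s) = p UNIV \<and> (\<forall>Z. p Z \<le> ereal (\<Sum>s\<in>Z. x $ s))}"

definition integral_points :: "(real ^ 's::finite) set" where
  "integral_points = {x. \<forall>s. x $ s \<in> \<int>}"


subsection \<open>Decreasing minimality\<close>

definition sorted_decreasing :: "real ^ 's::finite \<Rightarrow> real list" where
  "sorted_decreasing x =
     rev (sorted_list_of_multiset (image_mset (\<lambda>s. x $ s) (mset_set UNIV)))"

definition lex_le :: "real list \<Rightarrow> real list \<Rightarrow> bool" where
  "lex_le xs ys \<longleftrightarrow> xs = ys \<or> (xs, ys) \<in> lexord {(a, b). a < b}"

definition dec_min :: "(real ^ 's::finite) set \<Rightarrow> real ^ 's \<Rightarrow> bool" where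
  "dec_min Q m \<longleftrightarrow> m \<in> Q \<and> (\<forall>y\<in>Q. lex_le (sorted_decreasing m) (sorted_decreasing y))"


subsection \<open>Canonical chain, partition and essential values\<close>

text \<open>\<open>contr p C\<close> is the function \<open>p'\<close> obtained by contracting \<open>C\<close>; it is only meant for
  arguments disjoint from \<open>C\<close>.\<close>

definition contr :: "('s set \<Rightarrow> ereal) \<Rightarrow> 's set \<Rightarrow> 's set \<Rightarrow> ereal" where
  "contr p C X = p (X \<union> C) - p C"

text \<open>The sets \<open>X\<close> with \<open>contr p C X = -\<infinity>\<close> contribute \<open>-\<infinity>\<close> to the maximum and are left out,
  so that it is a maximum of integers; \<open>X = - C\<close> always contributes when \<open>C \<noteq> UNIV\<close>,
  because \<open>p UNIV\<close> is finite.\<close>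

definition max_ceiling :: "('s::finite set \<Rightarrow> ereal) \<Rightarrow> 's set \<Rightarrow> int" where
  "max_ceiling p C =
     Max {\<lceil>real_of_ereal (contr p C X) / real (card X)\<rceil> | X.
            X \<noteq> {} \<and> X \<subseteq> - C \<and> contr p C X \<noteq> -\<infinity>}"

definition excess :: "('s::finite set \<Rightarrow> ereal) \<Rightarrow> 's set \<Rightarrow> int \<Rightarrow> 's set \<Rightarrow> ereal" where
  "excess p C b X = contr p C X - ereal (of_int ((b - 1) * int (card X)))"

definition excess_maximizers :: "('s::finite set \<Rightarrow> ereal) \<Rightarrow> 's set \<Rightarrow> 's set set" where
  "excess_maximizers p C =
     {X. X \<subseteq> - C \<and>
         (\<forall>Y. Y \<subseteq> - C \<longrightarrow> excess p C (max_ceiling p C) Y \<le> excess p C (max_ceiling p C) X)}"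

text \<open>The chain is continued beyond the stopping index \<open>canon_len p\<close>, where it stays constantly
  \<open>UNIV\<close>; only the indices up to \<open>canon_len p\<close> are meaningful.\<close>

primrec canon_chain :: "('s::finite set \<Rightarrow> ereal) \<Rightarrow> nat \<Rightarrow> 's set" where
  "canon_chain p 0 = {}"
| "canon_chain p (Suc j) = canon_chain p j \<union> \<Inter> (excess_maximizers p (canon_chain p j))"

definition canon_len :: "('s::finite set \<Rightarrow> ereal) \<Rightarrow> nat" where
  "canon_len p = (LEAST j. canon_chain p j = UNIV)"

definition canon_part :: "('s::finite set \<Rightarrow> ereal) \<Rightarrow> nat \<Rightarrow> 's set" where
  "canon_part p j = \<Inter> (excess_maximizers p (canon_chain p (j - 1)))"

definition ess_value :: "('s::finite set \<Rightarrow> ereal) \<Rightarrow> nat \<Rightarrow> int" where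
  "ess_value p j = max_ceiling p (canon_chain p (j - 1))"


subsection \<open>Matroids, given by their basis families\<close>

definition matroid_basis_family :: "'s set \<Rightarrow> 's set set \<Rightarrow> bool" where
  "matroid_basis_family E \<B> \<longleftrightarrow>
     finite E \<and> \<B> \<noteq> {} \<and> (\<forall>L\<in>\<B>. L \<subseteq> E) \<and>
     (\<forall>L\<in>\<B>. \<forall>L'\<in>\<B>. \<forall>x\<in>L - L'. \<exists>y\<in>L' - L. insert y (L - {x}) \<in> \<B>)"

definition direct_sum_bases :: "'i set \<Rightarrow> ('i \<Rightarrow> 's set set) \<Rightarrow> 's set set" where
  "direct_sum_bases I \<B> = {\<Union>i\<in>I. L i | L. \<forall>i\<in>I. L i \<in> \<B> i}"

definition char_vec :: "'s set \<Rightarrow> real ^ 's::finite" where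
  "char_vec L = (\<chi> s. indicator L s)"

definition matroid_base_polyhedron :: "'s::finite set set \<Rightarrow> (real ^ 's) set" where
  "matroid_base_polyhedron \<B> = convex hull (char_vec ` \<B>)"

text \<open>With \<open>b = ess_value p i\<close>, the numbers \<open>r\<^sub>i\<close> and \<open>p\<^sub>i(X) - (\<beta>\<^sub>i - 1)|X|\<close> are values
  of \<open>excess\<close>.\<close>

definition canon_bases :: "('s::finite set \<Rightarrow> ereal) \<Rightarrow> nat \<Rightarrow> 's set set" where
  "canon_bases p i =
     {L. L \<subseteq> canon_part p i \<and>
         ereal (card L) = excess p (canon_chain p (i - 1)) (ess_value p i) (canon_part p i) \<and>
         (\<forall>X. X \<subseteq> canon_part p i \<longrightarrow>
            excess p (canon_chain p (i - 1)) (ess_value p i) X \<le> ereal (card (L \<inter> X)))}"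

definition canon_matroid_bases :: "('s::finite set \<Rightarrow> ereal) \<Rightarrow> 's set set" where
  "canon_matroid_bases p = direct_sum_bases {1..canon_len p} (canon_bases p)"

definition canon_shift :: "('s::finite set \<Rightarrow> ereal) \<Rightarrow> real ^ 's" where
  "canon_shift p =
     (\<chi> s. of_int (ess_value p (THE i. i \<in> {1..canon_len p} \<and> s \<in> canon_part p i) - 1))"


subsection \<open>Well-definedness of the canonical chain\<close>

context
  fixes p :: "'s::finite set \<Rightarrow> ereal"
  assumes int: "int_or_minf_valued p" and super: "supermodular p"
    and empty: "p {} = 0" and fin: "p UNIV \<noteq> -\<infinity>"
begin

lemma p_not_PInf: "p X \<noteq> \<infinity>"
proof -
  have "p X = -\<infinity> \<or> (\<exists>k::int. p X = ereal (of_int k))"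
    using int unfolding int_or_minf_valued_def by blast
  then show ?thesis by auto
qed

context
  fixes C :: "'s set"
  assumes C_fin: "p C \<noteq> -\<infinity>" and C_ne: "C \<noteq> UNIV"
begin

private abbreviation (input) h where "h \<equiv> excess p C (max_ceiling p C)"

lemma excess_empty: "excess p C b {} = 0"
  using C_fin p_not_PInf[of C] by (cases "p C") (auto simp: excess_def contr_def)

lemma excess_not_PInf: "excess p C b X \<noteq> \<infinity>"
  using C_fin p_not_PInf[of C] p_not_PInf[of "X \<union> C"]
  by (cases "p C"; cases "p (X \<union> C)") (auto simp: excess_def contr_def)

lemma contr_finite_witness: "contr p C (- C) \<noteq> -\<infinity>"
proof -
  have "- C \<union> C = UNIV" by blast
  then show ?thesis
    using C_fin fin p_not_PInf[of C] p_not_PInf[of UNIV]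
    by (cases "p C"; cases "p UNIV") (auto simp: contr_def)
qed

lemma max_ceiling_attained:
  obtains X where "X \<noteq> {}" "X \<subseteq> - C" "contr p C X \<noteq> -\<infinity>"
    "max_ceiling p C = \<lceil>real_of_ereal (contr p C X) / real (card X)\<rceil>"
proof -
  let ?A = "{\<lceil>real_of_ereal (contr p C X) / real (card X)\<rceil> | X.
            X \<noteq> {} \<and> X \<subseteq> - C \<and> contr p C X \<noteq> -\<infinity>}"
  have "finite ?A" by simp
  moreover have "- C \<noteq> {}" using C_ne by blast
  then have "\<lceil>real_of_ereal (contr p C (- C)) / real (card (- C))\<rceil> \<in> ?A"
    using contr_finite_witness by (intro CollectI exI[of _ "- C"]) simp
  then have "?A \<noteq> {}" by (metis empty_iff)
  ultimately have "max_ceiling p C \<in> ?A" unfolding max_ceiling_def by (rule Max_in)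
  then show thesis using that by blast
qed

lemma excess_pos:
  obtains X where "X \<noteq> {}" "X \<subseteq> - C" "h X > 0"
proof -
  obtain X where X: "X \<noteq> {}" "X \<subseteq> - C" "contr p C X \<noteq> -\<infinity>"
    "max_ceiling p C = \<lceil>real_of_ereal (contr p C X) / real (card X)\<rceil>"
    by (rule max_ceiling_attained)
  obtain r where r: "contr p C X = ereal r"
    using X(3) C_fin p_not_PInf[of C] p_not_PInf[of "X \<union> C"]
    by (cases "p C"; cases "p (X \<union> C)") (auto simp: contr_def)
  have c: "real (card X) > 0" using X(1) by (simp add: card_gt_0_iff)
  have "real_of_int (max_ceiling p C - 1) < r / real (card X)"
    using X(4) r by (simp add: ceiling_correct)
  then have "real_of_int (max_ceiling p C - 1) * real (card X) < r"
    using c by (simp add: pos_less_divide_eq)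
  then have "h X > 0" by (simp add: excess_def r)
  then show thesis using that X by blast
qed

lemma excess_supermodular:
  "excess p C b X + excess p C b Y \<le> excess p C b (X \<inter> Y) + excess p C b (X \<union> Y)"
proof -
  have s: "p (X \<union> C) + p (Y \<union> C) \<le> p ((X \<inter> Y) \<union> C) + p ((X \<union> Y) \<union> C)"
  proof -
    have "(X \<union> C) \<inter> (Y \<union> C) = (X \<inter> Y) \<union> C" "(X \<union> C) \<union> (Y \<union> C) = (X \<union> Y) \<union> C" by blast+
    then show ?thesis using super unfolding supermodular_def by metis
  qed
  have "int (card X) + int (card Y) = int (card (X \<inter> Y)) + int (card (X \<union> Y))"
    using card_Un_Int[of X Y] by simp
  then have c: "(b - 1) * int (card X) + (b - 1) * int (card Y)
      = (b - 1) * int (card (X \<inter> Y)) + (b - 1) * int (card (X \<union> Y))"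
    by (metis distrib_left)
  have c': "real_of_int ((b - 1) * int (card X)) + real_of_int ((b - 1) * int (card Y))
      = real_of_int ((b - 1) * int (card (X \<inter> Y))) + real_of_int ((b - 1) * int (card (X \<union> Y)))"
    using c by (metis of_int_add)
  have aux: "x - c - ereal a1 + (y - c - ereal a2) \<le> u - c - ereal a3 + (v - c - ereal a4)"
    if "x + y \<le> u + v" "a1 + a2 = a3 + a4" "\<bar>c\<bar> \<noteq> \<infinity>" "x \<noteq> \<infinity>" "y \<noteq> \<infinity>" "u \<noteq> \<infinity>" "v \<noteq> \<infinity>"
    for x y u v c :: ereal and a1 a2 a3 a4 :: real
    using that by (cases c; cases x; cases y; cases u; cases v) auto
  show ?thesis
    unfolding excess_def contr_def
    using C_fin p_not_PInf[of C] by (intro aux s c' p_not_PInf) auto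
qed

lemma maximizers_nonempty: "excess_maximizers p C \<noteq> {}"
proof -
  have "finite (h ` Pow (- C))" "h ` Pow (- C) \<noteq> {}" by auto
  then have "Max (h ` Pow (- C)) \<in> h ` Pow (- C)" by (rule Max_in)
  then obtain X where X: "X \<subseteq> - C" "h X = Max (h ` Pow (- C))" by auto
  have "h Y \<le> h X" if "Y \<subseteq> - C" for Y using that X by simp
  then show ?thesis using X(1) unfolding excess_maximizers_def by blast
qed

lemma maximizer_pos:
  assumes "X \<in> excess_maximizers p C"
  shows "h X > 0"
proof -
  obtain Y where "Y \<subseteq> - C" "h Y > 0" by (rule excess_pos)
  moreover have "h Y \<le> h X" using assms \<open>Y \<subseteq> - C\<close> unfolding excess_maximizers_def by blast
  ultimately show ?thesis by (blast intro: less_le_trans)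
qed

lemma maximizers_Int:
  assumes "X \<in> excess_maximizers p C" "Y \<in> excess_maximizers p C"
  shows "X \<inter> Y \<in> excess_maximizers p C"
proof -
  have X: "X \<subseteq> - C" "\<And>Z. Z \<subseteq> - C \<Longrightarrow> h Z \<le> h X" and Y: "Y \<subseteq> - C" "\<And>Z. Z \<subseteq> - C \<Longrightarrow> h Z \<le> h Y"
    using assms unfolding excess_maximizers_def by auto
  have eq: "h Y = h X" using X Y by (meson antisym)
  have U: "h (X \<union> Y) \<le> h X" using X Y by simp
  have I: "h X \<le> h (X \<inter> Y)"
    using excess_supermodular[of "max_ceiling p C" X Y] U eq maximizer_pos[OF assms(1)]
      excess_not_PInf[of "max_ceiling p C" X] excess_not_PInf[of "max_ceiling p C" "X \<inter> Y"]
    by (cases "h X"; cases "h (X \<inter> Y)"; cases "h (X \<union> Y)") auto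
  have "X \<inter> Y \<subseteq> - C" using X by blast
  moreover have "h Z \<le> h (X \<inter> Y)" if "Z \<subseteq> - C" for Z using X(2)[OF that] I by simp
  ultimately show ?thesis unfolding excess_maximizers_def by blast
qed

lemma Inter_maximizers: "\<Inter> (excess_maximizers p C) \<in> excess_maximizers p C"
proof -
  have "F \<noteq> {} \<Longrightarrow> F \<subseteq> excess_maximizers p C \<Longrightarrow> \<Inter> F \<in> excess_maximizers p C"
    if "finite F" for F
    using that
  proof (induction F rule: finite_induct)
    case (insert X F)
    then show ?case by (cases "F = {}") (auto intro: maximizers_Int)
  qed simp
  then show ?thesis using maximizers_nonempty by simp
qed

lemma block_ne: "\<Inter> (excess_maximizers p C) \<noteq> {}"
  using maximizer_pos[OF Inter_maximizers] excess_empty by auto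

lemma block_sub: "\<Inter> (excess_maximizers p C) \<subseteq> - C"
  using Inter_maximizers unfolding excess_maximizers_def by blast

lemma p_block_finite: "p (C \<union> \<Inter> (excess_maximizers p C)) \<noteq> -\<infinity>"
  using maximizer_pos[OF Inter_maximizers] C_fin p_not_PInf[of C]
  by (cases "p C") (auto simp: excess_def contr_def Un_commute)

lemma max_ceiling_decreasing:
  assumes D: "D = C \<union> \<Inter> (excess_maximizers p C)"
    and X: "X \<noteq> {}" "X \<subseteq> - D" "excess p D b X > 0"
  shows "b < max_ceiling p C"
proof -
  let ?T = "\<Inter> (excess_maximizers p C)"
  have XT: "X \<inter> ?T = {}" "X \<union> ?T \<subseteq> - C" using X D block_sub by blast+
  have le: "h (X \<union> ?T) \<le> h ?T"
    using Inter_maximizers XT(2) unfolding excess_maximizers_def by blast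
  have "card (X \<union> ?T) = card X + card ?T" using XT(1) by (simp add: card_Un_disjoint)
  moreover have un: "X \<union> ?T \<union> C = X \<union> D" "?T \<union> C = D" using D by blast+
  moreover obtain d where d: "p D = ereal d"
    using p_block_finite D p_not_PInf[of D] by (cases "p D") auto
  moreover obtain c where c: "p C = ereal c" using C_fin p_not_PInf[of C] by (cases "p C") auto
  moreover obtain e where e: "p (X \<union> D) = ereal e"
    using X(3) d p_not_PInf[of "X \<union> D"] by (cases "p (X \<union> D)") (auto simp: excess_def contr_def)
  ultimately have "e - d \<le> (real_of_int (max_ceiling p C) - 1) * real (card X)"
    using le unfolding excess_def contr_def by (simp add: algebra_simps)
  moreover have "(real_of_int b - 1) * real (card X) < e - d"
    using X(3) d e unfolding excess_def contr_def by simp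
  ultimately have "(real_of_int b - 1) * real (card X)
      < (real_of_int (max_ceiling p C) - 1) * real (card X)" by linarith
  then show ?thesis by (simp add: mult_less_cancel_right)
qed

end

lemma maximizers_UNIV: "\<Inter> (excess_maximizers p UNIV) = {}"
  by (auto simp: excess_maximizers_def)

lemma p_canon_chain_finite: "p (canon_chain p j) \<noteq> -\<infinity>"
proof (induction j)
  case (Suc j)
  then show ?case using p_block_finite fin by (cases "canon_chain p j = UNIV") auto
qed (simp add: empty)

lemma canon_chain_strict: "canon_chain p j \<noteq> UNIV \<Longrightarrow> canon_chain p j \<subset> canon_chain p (Suc j)"
  using block_ne[OF p_canon_chain_finite, of j] block_sub[OF p_canon_chain_finite, of j]
  unfolding canon_chain.simps by blast

lemma canon_chain_reaches_UNIV: "\<exists>j. canon_chain p j = UNIV"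
proof (rule ccontr)
  assume "\<not> ?thesis"
  then have "card (canon_chain p j) < card (canon_chain p (Suc j))" for j
    by (intro psubset_card_mono canon_chain_strict) auto
  then have grow: "j \<le> card (canon_chain p j)" for j
  proof (induction j)
    case (Suc j)
    from Suc.IH[OF Suc.prems] Suc.prems[of j] show ?case by linarith
  qed simp
  have "card (canon_chain p (Suc (card (UNIV :: 's set)))) \<le> card (UNIV :: 's set)"
    by (intro card_mono) auto
  with grow[of "Suc (card (UNIV :: 's set))"] show False by linarith
qed

lemma canon_chain_len: "canon_chain p (canon_len p) = UNIV"
  unfolding canon_len_def using canon_chain_reaches_UNIV by (rule LeastI_ex)

lemma canon_chain_before_len: "j < canon_len p \<Longrightarrow> canon_chain p j \<noteq> UNIV"
  unfolding canon_len_def by (rule not_less_Least)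

lemma canon_chain_eq: "canon_chain p j = (\<Union>i\<in>{1..j}. canon_part p i)"
  by (induction j) (auto simp: canon_part_def atLeastAtMostSuc_conv)

lemma canon_part_partition: "\<exists>!i. i \<in> {1..canon_len p} \<and> s \<in> canon_part p i"
proof -
  have disj: "canon_part p i \<inter> canon_part p k = {}" if "1 \<le> i" "i < k" "k \<le> canon_len p" for i k
  proof -
    have "canon_part p i \<subseteq> canon_chain p (k - 1)"
      unfolding canon_chain_eq using that by (intro UN_upper) auto
    moreover have "canon_part p k \<subseteq> - canon_chain p (k - 1)"
      unfolding canon_part_def using that
      by (intro block_sub p_canon_chain_finite canon_chain_before_len) auto
    ultimately show ?thesis by blast
  qed
  obtain i where i: "i \<in> {1..canon_len p}" "s \<in> canon_part p i"
    using canon_chain_len canon_chain_eq[of "canon_len p"] by blast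
  show ?thesis
  proof (rule ex1I[of _ i])
    fix k assume "k \<in> {1..canon_len p} \<and> s \<in> canon_part p k"
    then show "k = i" using disj[of i k] disj[of k i] i by (cases i k rule: linorder_cases) auto
  qed (use i in blast)
qed

lemma ess_value_decreasing:
  assumes "1 \<le> j" "j < canon_len p"
  shows "ess_value p (Suc j) < ess_value p j"
proof -
  obtain k where k: "j = Suc k" using assms(1) by (cases j) auto
  have ne: "canon_chain p k \<noteq> UNIV" "canon_chain p j \<noteq> UNIV"
    using assms k by (auto intro!: canon_chain_before_len simp del: canon_chain.simps)
  obtain X where "X \<noteq> {}" "X \<subseteq> - canon_chain p j"
    "excess p (canon_chain p j) (max_ceiling p (canon_chain p j)) X > 0"
    by (rule excess_pos[OF p_canon_chain_finite ne(2)])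
  then show ?thesis
    using max_ceiling_decreasing[OF p_canon_chain_finite ne(1), of "canon_chain p j" X] k
    by (simp add: ess_value_def)
qed

end

end

theory Submission imports Defs begin

text \<open>
  Call \<open>x\<close> canonical at \<open>i\<close> if its entries on \<open>S\<^sub>i\<close> are \<open>\<beta>\<^sub>i - 1\<close> or \<open>\<beta>\<^sub>i\<close> and
  \<open>x(C\<^sub>i) = p(C\<^sub>i)\<close>. Vectors that are canonical at every \<open>i\<close> all have the same multiset of
  entries, and in \<open>B\<close> they are exactly the vectors \<open>\<chi>\<^sub>L + \<Delta>\<^sup>*\<close>. If an integral \<open>x \<in> B\<close> first
  fails to be canonical at \<open>i\<close>, it agrees with a canonical \<open>m\<close> on \<open>C\<^sub>i\<^sub>-\<^sub>1\<close> up to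
  rearrangement, whereas outside \<open>C\<^sub>i\<^sub>-\<^sub>1\<close> it has an entry above \<open>\<beta>\<^sub>i\<close>, or else more than
  \<open>r\<^sub>i\<close> entries equal to \<open>\<beta>\<^sub>i\<close>, because \<open>x(S\<^sub>i) \<ge> p\<^sub>i(S\<^sub>i)\<close> with equality only in the canonical
  case. Hence \<open>m\<close> is strictly smaller. Canonical vectors exist because an inclusionwise minimal set \<open>L\<close>
  with \<open>|L \<inter> X| \<ge> h(X)\<close> for all \<open>X\<close> is covered by tight sets, whose union is tight by
  supermodularity. Finally, a 0/1-vector is a vertex of the unit cube, so it lies in the hull of a
  set of 0/1-vectors only if it belongs to that set.
\<close>

section \<open>Sorted vectors compared through entry multiplicities\<close>

lemma sorted_list_of_multiset_split:
  fixes M :: "'a::linorder multiset"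
  shows "sorted_list_of_multiset M =
    sorted_list_of_multiset (filter_mset (\<lambda>a. a < t) M) @ replicate (count M t) t @
    sorted_list_of_multiset (filter_mset (\<lambda>a. t < a) M)" (is "_ = ?R")
proof -
  have "sorted ?R" by (auto simp: sorted_append)
  moreover have "mset ?R = M" by (auto simp: multiset_eq_iff)
  ultimately show ?thesis by (metis sorted_list_of_multiset_mset sorted_sort_id)
qed

lemma count_values:
  fixes x :: "real ^ 's::finite"
  shows "count (image_mset (\<lambda>s. x $ s) (mset_set UNIV)) v = card {s. x $ s = v}"
  by (simp add: count_image_mset' eq_commute[of v])

lemma sorted_decreasing_eqI:
  assumes "\<And>v. card {s. x $ s = v} = card {s. y $ s = v}"
  shows "sorted_decreasing x = sorted_decreasing y"
proof -
  have "image_mset (\<lambda>s. x $ s) (mset_set UNIV) = image_mset (\<lambda>s. y $ s) (mset_set UNIV)"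
    unfolding multiset_eq_iff count_values using assms by simp
  then show ?thesis by (simp add: sorted_decreasing_def)
qed

text \<open>Both sorted lists begin with the same entries above \<open>t\<close>, then agree on as
  many copies of \<open>t\<close> as \<open>x\<close> has. At the next position \<open>y\<close>
  still has \<open>t\<close> and \<open>x\<close> something smaller, which decides the
  comparison.\<close>

lemma sorted_decreasing_lessI:
  fixes x y :: "real ^ 's::finite"
  assumes above: "\<And>v. t < v \<Longrightarrow> card {s. x $ s = v} = card {s. y $ s = v}"
    and at: "card {s. x $ s = t} < card {s. y $ s = t}"
  shows "(sorted_decreasing x, sorted_decreasing y) \<in> lexord {(a, b). a < b}"
proof -
  define M where "M z = image_mset (\<lambda>s. z $ s) (mset_set UNIV)" for z :: "real ^ 's"
  define hi where "hi z = rev (sorted_list_of_multiset (filter_mset (\<lambda>a. t < a) (M z)))" for z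
  define lo where "lo z = rev (sorted_list_of_multiset (filter_mset (\<lambda>a. a < t) (M z)))" for z
  define n where "n z = card {s. z $ s = t}" for z :: "real ^ 's"
  have split: "sorted_decreasing z = hi z @ replicate (n z) t @ lo z" for z
    unfolding sorted_decreasing_def
    by (subst sorted_list_of_multiset_split[of _ t])
      (simp add: hi_def lo_def M_def n_def count_values)
  have "filter_mset (\<lambda>a. t < a) (M x) = filter_mset (\<lambda>a. t < a) (M y)"
    unfolding M_def multiset_eq_iff count_filter_mset count_values using above by simp
  then have hi: "hi x = hi y" by (simp add: hi_def)
  \<comment> \<open>Writing the surplus as \<open>Suc k\<close> exposes a head \<open>t\<close>,
    which exceeds the head of \<open>lo x\<close> and, by the prefix rule of \<open>lexord\<close>,
    also settles an empty \<open>lo x\<close>.\<close>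
  obtain k where k: "n y = n x + Suc k"
    using at unfolding n_def by (metis less_iff_Suc_add add_Suc_right)
  have "(lo x, t # replicate k t @ lo y) \<in> lexord {(a, b). a < b}"
  proof (cases "lo x")
    case (Cons a as)
    then have "a \<in> set (lo x)" by simp
    then have "a < t" by (simp add: lo_def)
    then show ?thesis using Cons by simp
  qed simp
  then show ?thesis
    unfolding split hi k replicate_add by (simp add: lexord_append_leftI)
qed

section \<open>Matroids defined by integer-valued supermodular lower bounds\<close>

text \<open>Tight sets of a feasible \<open>L\<close> can be uncrossed. \<open>le_card\<close> makes
  \<open>E\<close> itself feasible, so minimal feasible sets exist; \<open>le_E\<close> caps their
  size at \<open>h E\<close>. Exchange happens inside a smallest tight set.\<close>

lemma supermodular_matroid_basis_family:
  fixes h :: "'s::finite set \<Rightarrow> ereal"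
  assumes int: "int_or_minf_valued h" and super: "supermodular h" and empty: "h {} = 0"
    and le_E: "\<And>X. X \<subseteq> E \<Longrightarrow> h X \<le> h E"
    and le_card: "\<And>X. X \<subseteq> E \<Longrightarrow> h X \<le> ereal (card X)"
  shows "matroid_basis_family E
    {L. L \<subseteq> E \<and> ereal (card L) = h E \<and> (\<forall>X. X \<subseteq> E \<longrightarrow> h X \<le> ereal (card (L \<inter> X)))}"
    (is "matroid_basis_family E ?B")
proof -
  define feas where "feas L \<longleftrightarrow> L \<subseteq> E \<and> (\<forall>X. X \<subseteq> E \<longrightarrow> h X \<le> ereal (card (L \<inter> X)))" for L
  define tight where "tight L X \<longleftrightarrow> X \<subseteq> E \<and> h X = ereal (card (L \<inter> X))" for L X
  have tight: "tight L (X \<inter> Y)" "tight L (X \<union> Y)"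
    if f: "feas L" and t: "tight L X" "tight L Y" for L X Y
  proof -
    have sub: "X \<inter> Y \<subseteq> E" "X \<union> Y \<subseteq> E" using t unfolding tight_def by auto
    have le: "h (X \<inter> Y) \<le> ereal (card (L \<inter> (X \<inter> Y)))" "h (X \<union> Y) \<le> ereal (card (L \<inter> (X \<union> Y)))"
      using f sub unfolding feas_def by blast+
    have "(L \<inter> X) \<union> (L \<inter> Y) = L \<inter> (X \<union> Y)" "(L \<inter> X) \<inter> (L \<inter> Y) = L \<inter> (X \<inter> Y)" by blast+
    then have "card (L \<inter> X) + card (L \<inter> Y) = card (L \<inter> (X \<union> Y)) + card (L \<inter> (X \<inter> Y))"
      using card_Un_Int[of "L \<inter> X" "L \<inter> Y"] by simp
    then have c: "real (card (L \<inter> X)) + real (card (L \<inter> Y)) =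
        real (card (L \<inter> (X \<union> Y))) + real (card (L \<inter> (X \<inter> Y)))"
      by (metis of_nat_add)
    have s: "h X + h Y \<le> h (X \<inter> Y) + h (X \<union> Y)" using super unfolding supermodular_def by blast
    \<comment> \<open>As \<open>X\<close> and \<open>Y\<close> are tight, \<open>s\<close> and
      \<open>c\<close> bound the sum of the right-hand sides of \<open>le\<close> by that of the
      left-hand sides, so both inequalities are equalities.\<close>
    have "h (X \<inter> Y) = ereal (card (L \<inter> (X \<inter> Y))) \<and> h (X \<union> Y) = ereal (card (L \<inter> (X \<union> Y)))"
      using s le c t unfolding tight_def
      by (cases "h (X \<inter> Y)"; cases "h (X \<union> Y)") auto
    then show "tight L (X \<inter> Y)" "tight L (X \<union> Y)" using sub unfolding tight_def by blast+
  qed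
  \<comment> \<open>Integrality turns strictness into a gap of one, exactly what removing one
    element of \<open>L\<close> can cost.\<close>
  have slack: "h X \<le> ereal (card (L \<inter> X) - 1)" if "feas L" "X \<subseteq> E" "\<not> tight L X" for L X
  proof -
    have le: "h X < ereal (card (L \<inter> X))"
      using that unfolding feas_def tight_def by (auto simp: order.strict_iff_order)
    have "h X = -\<infinity> \<or> (\<exists>k::int. h X = ereal (of_int k))"
      using int unfolding int_or_minf_valued_def by blast
    then show ?thesis
    proof
      assume "\<exists>k::int. h X = ereal (of_int k)"
      then obtain k :: int where k: "h X = ereal (of_int k)" by blast
      then have "real_of_int k < real_of_int (int (card (L \<inter> X)))" using le by simp
      then have "k < int (card (L \<inter> X))" by (simp only: of_int_less_iff)
      then show ?thesis using k by simp
    qed simp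
  qed
  have tight_Union: "tight L (\<Union>F)" if "feas L" "finite F" "\<And>X. X \<in> F \<Longrightarrow> tight L X" for L F
    using that(2,3)
  proof (induction F rule: finite_induct)
    case empty
    then show ?case by (simp add: tight_def assms(3) zero_ereal_def)
  next
    case (insert X F)
    then show ?case using tight(2)[OF that(1)] by simp
  qed
  have tight_Inter: "tight L (\<Inter>F)"
    if "feas L" "finite F" "F \<noteq> {}" "\<And>X. X \<in> F \<Longrightarrow> tight L X" for L F
    using that(2,3,4)
  proof (induction F rule: finite_ne_induct)
    case (insert X F)
    then show ?case using tight(1)[OF that(1)] by simp
  qed simp
  have B: "?B = {L. feas L \<and> ereal (card L) = h E}" unfolding feas_def by blast
  have ne: "?B \<noteq> {}"
  proof -
    have "feas E" using le_card by (simp add: feas_def Int_absorb1)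
    then obtain L where L: "feas L" and min: "\<And>K. feas K \<Longrightarrow> K \<subseteq> L \<Longrightarrow> K = L"
      using finite_has_minimal[of "Collect feas"] by auto
    \<comment> \<open>If no tight set contained \<open>v\<close>, all constraints on sets through
      \<open>v\<close> would have slack one and \<open>L - {v}\<close> would be feasible, against
      minimality.\<close>
    have ex: "\<exists>X. tight L X \<and> v \<in> X" if v: "v \<in> L" for v
    proof (rule ccontr)
      assume no: "\<nexists>X. tight L X \<and> v \<in> X"
      have "h X \<le> ereal (card ((L - {v}) \<inter> X))" if X: "X \<subseteq> E" for X
      proof (cases "v \<in> X")
        case True
        have "h X \<le> ereal (card (L \<inter> X) - 1)" using no True slack[OF L X] by blast
        moreover have "card (L \<inter> X) > 0" using v True by (auto simp: card_gt_0_iff)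
        moreover have "(L - {v}) \<inter> X = (L \<inter> X) - {v}" by blast
        ultimately show ?thesis using v True by simp
      next
        case False
        then have "(L - {v}) \<inter> X = L \<inter> X" by blast
        then show ?thesis using L X unfolding feas_def by simp
      qed
      then have "feas (L - {v})" using L unfolding feas_def by blast
      then show False using min v by blast
    qed
    define T where "T = \<Union> {X. tight L X}"
    have T: "tight L T" unfolding T_def by (rule tight_Union[OF L]) auto
    have "L \<inter> T = L" using ex unfolding T_def by blast
    \<comment> \<open>Here \<open>card L = card (L \<inter> T) = h T\<close>, and \<open>h T\<close>
      is at most \<open>h E\<close>.\<close>
    then have "ereal (card L) \<le> h E" using T le_E unfolding tight_def by metis
    moreover have "h E \<le> ereal (card L)" using L unfolding feas_def by (metis Int_absorb2 order_refl)
    ultimately show ?thesis using L unfolding B by force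
  qed
  have exchange: "\<exists>y\<in>L' - L. insert y (L - {x}) \<in> ?B"
    if L: "L \<in> ?B" and L': "L' \<in> ?B" and x: "x \<in> L - L'" for L L' x
  proof -
    have fL: "feas L" "ereal (card L) = h E" and fL': "feas L'" using L L' unfolding B by auto
    have LE: "L \<subseteq> E" "L' \<subseteq> E" using L L' by auto
    \<comment> \<open>An exchange inside the smallest tight set containing \<open>x\<close> cannot violate a tight constraint.\<close>
    define T where "T = \<Inter> {X. tight L X \<and> x \<in> X}"
    \<comment> \<open>So the family defining \<open>T\<close> is nonempty.\<close>
    have "tight L E" using fL LE by (simp add: tight_def Int_absorb2)
    then have T: "tight L T" "x \<in> T" unfolding T_def
      using LE x by (auto intro!: tight_Inter[OF fL(1)])
    \<comment> \<open>\<open>L'\<close> meets \<open>T\<close> in at least as many elements as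
      \<open>L\<close> and misses \<open>x\<close>, so it has an element of \<open>T\<close> outside
      \<open>L\<close>.\<close>
    have "ereal (card (L \<inter> T)) \<le> ereal (card (L' \<inter> T))"
      using T fL' unfolding tight_def feas_def by metis
    then have "card (L \<inter> T) \<le> card (L' \<inter> T)" by simp
    then have "\<not> L' \<inter> T \<subset> L \<inter> T" using psubset_card_mono[of "L \<inter> T" "L' \<inter> T"] by auto
    then obtain y where y: "y \<in> L' - L" "y \<in> T" using x T by blast
    let ?K = "insert y (L - {x})"
    have "h X \<le> ereal (card (?K \<inter> X))" if X: "X \<subseteq> E" for X
    \<comment> \<open>Only sets containing \<open>x\<close> but not \<open>y\<close> lose an
      element. Such an \<open>X\<close> is not tight, as it would include \<open>T\<close> and hence
      \<open>y\<close>; its slack pays for the loss.\<close>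
    proof (cases "x \<in> X \<and> y \<notin> X")
      case True
      then have "\<not> tight L X" using y unfolding T_def by blast
      then have "h X \<le> ereal (card (L \<inter> X) - 1)" using slack[OF fL(1) X] by blast
      moreover have "card (L \<inter> X) > 0" using x True by (auto simp: card_gt_0_iff)
      moreover have "?K \<inter> X = (L \<inter> X) - {x}" using True by blast
      ultimately show ?thesis using x True by simp
    next
      case False
      have "card (L \<inter> X) \<le> card (?K \<inter> X)"
      proof (cases "x \<in> X")
        case True
        then have "?K \<inter> X = insert y ((L \<inter> X) - {x})" using False by blast
        then show ?thesis using y by (simp add: card_Diff_singleton_if) linarith
      next
        case False
        then show ?thesis by (intro card_mono) auto
      qed
      then show ?thesis
        using fL(1) X unfolding feas_def by (meson ereal_less_eq(3) of_nat_le_iff order_trans)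
    qed
    moreover have "card ?K = card L"
      using x y card_Suc_Diff1[of L x] by simp
    ultimately have "?K \<in> ?B" using fL LE y unfolding B feas_def by auto
    then show ?thesis using y(1) by blast
  qed
  show ?thesis unfolding matroid_basis_family_def
  proof (intro conjI ballI)
    show "L \<subseteq> E" if "L \<in> ?B" for L using that by simp
  qed (use ne exchange in simp_all)
qed

section \<open>Integral points in hulls of 0/1-vectors\<close>

lemma char_vec_in_hull_imp_mem:
  assumes "char_vec L \<in> convex hull (char_vec ` F)"
  shows "L \<in> F"
proof (rule ccontr)
  assume L: "L \<notin> F"
  \<comment> \<open>On 0/1-vectors, \<open>a\<close> attains its minimum \<open>- |L|\<close> at \<open>L\<close> only.\<close>
  define a :: "real ^ 'a" where "a = (\<chi> s. if s \<in> L then -1 else 1)"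
  have val: "a \<bullet> char_vec K = real (card (K - L)) - real (card (K \<inter> L))" for K
  proof -
    have "a \<bullet> char_vec K = (\<Sum>s\<in>UNIV. indicator (K - L) s - indicator (K \<inter> L) s)"
      unfolding inner_vec_def a_def char_vec_def by (intro sum.cong) (auto simp: indicator_def)
    then show ?thesis by (simp add: sum_subtractf indicator_def set_diff_eq Int_def)
  qed
  \<comment> \<open>Integrality puts every \<open>K\<close> in \<open>F\<close> at least one above
    the value at \<open>L\<close>, so one closed half-space contains the hull and excludes
    \<open>char_vec L\<close>.\<close>
  have "a \<bullet> char_vec K \<ge> 1 - real (card L)" if "K \<in> F" for K
  proof (cases "K \<subseteq> L")
    case True
    then have "card K < card L" using that L by (metis finite psubsetI psubset_card_mono)
    then show ?thesis using True by (simp add: val Int_absorb2 Diff_eq_empty_iff[THEN iffD2])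
  next
    case False
    then have "card (K - L) > 0" by (simp add: card_gt_0_iff)
    moreover have "card (K \<inter> L) \<le> card L" by (intro card_mono) auto
    ultimately show ?thesis unfolding val by linarith
  qed
  then have "convex hull (char_vec ` F) \<subseteq> {y. a \<bullet> y \<ge> 1 - real (card L)}"
    by (intro hull_minimal convex_halfspace_ge) auto
  then show False using assms val[of L] by auto
qed

text \<open>The hull lies in the unit cube, so its integral points are 0/1-vectors, and vertices of
  the cube enter the hull only as generators.\<close>

lemma integral_in_hull_char_vec:
  assumes "y \<in> convex hull (char_vec ` F)" "y \<in> integral_points"
  obtains L where "L \<in> F" "y = char_vec L"
proof -
  have "convex hull (char_vec ` F) \<subseteq> cbox 0 1"
    by (intro hull_minimal convex_box) (auto simp: mem_box_cart char_vec_def indicator_def)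
  then have b: "0 \<le> y $ s" "y $ s \<le> 1" for s using assms(1) by (auto simp: mem_box_cart)
  have "y $ s = 0 \<or> y $ s = 1" for s
  proof -
    obtain k where "y $ s = of_int k" using assms(2) by (auto simp: integral_points_def elim: Ints_cases)
    then show ?thesis using b[of s] by (cases "k \<le> 0") auto
  qed
  then have "y = char_vec {s. y $ s = 1}"
    by (auto simp: vec_eq_iff char_vec_def indicator_def)
  then show thesis using that char_vec_in_hull_imp_mem assms(1) by metis
qed

section \<open>Canonical vectors and bounds on the excess\<close>

lemma sum_two_values:
  fixes x :: "real ^ 's::finite"
  assumes "\<And>s. s \<in> X \<Longrightarrow> x $ s = b - 1 \<or> x $ s = b"
  shows "(\<Sum>s\<in>X. x $ s) = (b - 1) * card X + card {s\<in>X. x $ s = b}"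
proof -
  have "(\<Sum>s\<in>X. x $ s) = (\<Sum>s\<in>X. (b - 1) + of_bool (x $ s = b))"
    using assms by (intro sum.cong) auto
  then show ?thesis by (simp add: sum.distrib Int_def)
qed

text \<open>Tightness on two consecutive chain sets fixes the sum over the block between them, hence
  how many entries there take the larger value. Membership in the base-polyhedron is kept
  separate.\<close>

definition canonical_at :: "('s::finite set \<Rightarrow> ereal) \<Rightarrow> real ^ 's \<Rightarrow> nat \<Rightarrow> bool" where
  "canonical_at p x i \<longleftrightarrow>
     (\<forall>s\<in>canon_part p i. x $ s = real_of_int (ess_value p i) - 1 \<or> x $ s = real_of_int (ess_value p i)) \<and>
     p (canon_chain p i) = ereal (\<Sum>s\<in>canon_chain p i. x $ s)"

lemma excess_ereal:
  assumes "p (X \<union> C) = ereal a" "p C = ereal c"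
  shows "excess p C b X = ereal (a - c - (real_of_int b - 1) * card X)"
  using assms by (simp add: excess_def contr_def)

text \<open>Phrased as an equivalence of bounds so that it also covers infinite
  \<open>p (X \<union> C)\<close>, unlike \<open>excess_ereal\<close>.\<close>

lemma excess_le_iff:
  assumes "p C = ereal c"
  shows "excess p C b X \<le> ereal k \<longleftrightarrow> p (X \<union> C) \<le> ereal (c + (real_of_int b - 1) * card X + k)"
  using assms by (cases "p (X \<union> C)") (auto simp: excess_def contr_def)

context
  fixes p :: "'s::finite set \<Rightarrow> ereal"
  assumes int: "int_or_minf_valued p" and super: "supermodular p"
    and empty: "p {} = 0" and fin: "p UNIV \<noteq> -\<infinity>"
begin

lemmas p_assms = int super empty fin

section \<open>The matroid on each canonical block\<close>

lemma int_or_minf_valued_excess: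
  assumes "p C \<noteq> -\<infinity>"
  shows "int_or_minf_valued (excess p C b)"
proof -
  have "excess p C b X = -\<infinity> \<or> (\<exists>k::int. excess p C b X = ereal (of_int k))" for X
  proof -
    have v: "p Y = -\<infinity> \<or> (\<exists>k::int. p Y = ereal (of_int k))" for Y
      using int unfolding int_or_minf_valued_def by blast
    obtain c :: int where c: "p C = ereal (of_int c)" using v[of C] assms by blast
    from v[of "X \<union> C"] show ?thesis
    proof
      assume "\<exists>k::int. p (X \<union> C) = ereal (of_int k)"
      then obtain k :: int where "p (X \<union> C) = ereal (of_int k)" by blast
      then have "excess p C b X = ereal (of_int (k - c - (b - 1) * int (card X)))"
        using c by (simp add: excess_ereal)
      then show ?thesis by blast
    qed (simp add: c excess_def contr_def)
  qed
  then show ?thesis unfolding int_or_minf_valued_def by blast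
qed

text \<open>The maximal ceiling \<open>\<beta>\<close> gives
  \<open>contr p C X \<le> \<beta> |X|\<close>; subtracting \<open>(\<beta> - 1) |X|\<close> leaves
  at most \<open>|X|\<close>. The empty set and sets of value \<open>-\<infinity>\<close> are
  outside that maximum and are treated apart.\<close>

lemma excess_le_card:
  assumes C: "p C \<noteq> -\<infinity>" "C \<noteq> UNIV" and X: "X \<subseteq> - C"
  shows "excess p C (max_ceiling p C) X \<le> ereal (card X)"
proof -
  obtain c where c: "p C = ereal c" using C(1) p_not_PInf[OF p_assms, of C] by (cases "p C") auto
  consider "X = {}" | "p (X \<union> C) = -\<infinity>" | r where "X \<noteq> {}" "p (X \<union> C) = ereal r"
    using p_not_PInf[OF p_assms, of "X \<union> C"] by (cases "p (X \<union> C)") auto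
  then show ?thesis
  proof cases
    case 1
    then show ?thesis using excess_empty[OF p_assms C] by simp
  next
    case 2
    then show ?thesis using c by (simp add: excess_le_iff)
  next
    case 3
    have contr: "contr p C X = ereal (r - c)" using 3 c by (simp add: contr_def)
    have "\<lceil>(r - c) / card X\<rceil> \<le> max_ceiling p C"
      unfolding max_ceiling_def using 3 X contr by (intro Max_ge CollectI exI[of _ X]) auto
    then have "(r - c) / card X \<le> max_ceiling p C" by (simp add: ceiling_le_iff)
    moreover have "real (card X) > 0" using 3 by (simp add: card_gt_0_iff)
    ultimately have "r - c \<le> real_of_int (max_ceiling p C) * card X" by (simp add: pos_divide_le_eq)
    then show ?thesis using 3 c by (simp add: excess_le_iff algebra_simps)
  qed
qed

text \<open>Maximizers of the excess are closed under intersection, so the block is itself a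
  maximizer; this yields \<open>canon_part_max\<close>.\<close>

lemma canon_block:
  assumes "i \<in> {1..canon_len p}"
  shows canon_chain_pred_ne: "canon_chain p (i - 1) \<noteq> UNIV"
    and canon_part_sub: "canon_part p i \<subseteq> - canon_chain p (i - 1)"
    and canon_chain_step: "canon_chain p i = canon_part p i \<union> canon_chain p (i - 1)"
    and canon_part_max: "X \<subseteq> - canon_chain p (i - 1) \<Longrightarrow>
      excess p (canon_chain p (i - 1)) (ess_value p i) X
      \<le> excess p (canon_chain p (i - 1)) (ess_value p i) (canon_part p i)"
proof -
  show ne: "canon_chain p (i - 1) \<noteq> UNIV"
    using assms canon_chain_before_len[OF p_assms, of "i - 1"] by fastforce
  show "canon_part p i \<subseteq> - canon_chain p (i - 1)"
    unfolding canon_part_def by (rule block_sub[OF p_assms p_canon_chain_finite[OF p_assms] ne])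
  show "canon_chain p i = canon_part p i \<union> canon_chain p (i - 1)"
    using assms by (cases i) (auto simp: canon_part_def)
  show "excess p (canon_chain p (i - 1)) (ess_value p i) X
      \<le> excess p (canon_chain p (i - 1)) (ess_value p i) (canon_part p i)"
    if "X \<subseteq> - canon_chain p (i - 1)"
    using Inter_maximizers[OF p_assms p_canon_chain_finite[OF p_assms] ne] that
    unfolding canon_part_def ess_value_def excess_maximizers_def by blast
qed

lemma canon_bases_matroid:
  assumes i: "i \<in> {1..canon_len p}"
  shows "matroid_basis_family (canon_part p i) (canon_bases p i)"
  unfolding canon_bases_def
proof (rule supermodular_matroid_basis_family)
  note C = p_canon_chain_finite[OF p_assms, of "i - 1"] canon_chain_pred_ne[OF i]
  show "int_or_minf_valued (excess p (canon_chain p (i - 1)) (ess_value p i))"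
    by (rule int_or_minf_valued_excess[OF C(1)])
  show "supermodular (excess p (canon_chain p (i - 1)) (ess_value p i))"
    unfolding supermodular_def using excess_supermodular[OF p_assms C] by blast
  show "excess p (canon_chain p (i - 1)) (ess_value p i) {} = 0"
    by (rule excess_empty[OF p_assms C])
  fix X assume "X \<subseteq> canon_part p i"
  then have X: "X \<subseteq> - canon_chain p (i - 1)" using canon_part_sub[OF i] by blast
  show "excess p (canon_chain p (i - 1)) (ess_value p i) X
      \<le> excess p (canon_chain p (i - 1)) (ess_value p i) (canon_part p i)"
    by (rule canon_part_max[OF i X])
  show "excess p (canon_chain p (i - 1)) (ess_value p i) X \<le> ereal (card X)"
    unfolding ess_value_def by (rule excess_le_card[OF C X])
qed

lemma canon_chain_sum:
  assumes "i \<in> {1..canon_len p}"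
  shows "(\<Sum>s\<in>canon_chain p i. f s) = (\<Sum>s\<in>canon_part p i. f s) + (\<Sum>s\<in>canon_chain p (i - 1). f s)"
  using canon_part_sub[OF assms] unfolding canon_chain_step[OF assms]
  by (intro sum.union_disjoint) auto

lemma canon_shift_nth:
  assumes "i \<in> {1..canon_len p}" "s \<in> canon_part p i"
  shows "canon_shift p $ s = real_of_int (ess_value p i) - 1"
proof -
  have "(THE i. i \<in> {1..canon_len p} \<and> s \<in> canon_part p i) = i"
    using canon_part_partition[OF p_assms, of s] assms by (intro the1_equality) auto
  then show ?thesis by (simp add: canon_shift_def)
qed

lemma ess_value_strict_decreasing:
  assumes "1 \<le> i" "i < k" "k \<le> canon_len p"
  shows "ess_value p k < ess_value p i"
  using assms(2,3)
proof (induction k)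
  case (Suc k)
  then have "ess_value p (Suc k) < ess_value p k"
    using assms(1) by (intro ess_value_decreasing[OF p_assms]) auto
  then show ?case using Suc by (cases "i = k") auto
qed simp

section \<open>Tightness and entry multiplicities of canonical vectors\<close>

lemma canonical_chain_tight:
  assumes "\<And>k. k \<in> {1..j} \<Longrightarrow> canonical_at p x k"
  shows "p (canon_chain p j) = ereal (\<Sum>s\<in>canon_chain p j. x $ s)"
  using assms[of j] empty by (cases j) (auto simp: canonical_at_def zero_ereal_def)

text \<open>Tightness on \<open>C\<close> turns the constraint for \<open>X \<union> C\<close> into
  one on \<open>X\<close> alone.\<close>

lemma base_polyhedron_excess_le:
  assumes x: "x \<in> base_polyhedron p" and C: "p C = ereal (\<Sum>s\<in>C. x $ s)" and X: "X \<subseteq> - C"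
  shows "excess p C b X \<le> ereal ((\<Sum>s\<in>X. x $ s) - (real_of_int b - 1) * card X)"
proof -
  have "(\<Sum>s\<in>X \<union> C. x $ s) = (\<Sum>s\<in>X. x $ s) + (\<Sum>s\<in>C. x $ s)"
    using X by (intro sum.union_disjoint) auto
  moreover have "p (X \<union> C) \<le> ereal (\<Sum>s\<in>X \<union> C. x $ s)"
    using x unfolding base_polyhedron_def by blast
  ultimately show ?thesis using C by (simp add: excess_le_iff add.commute)
qed

text \<open>Tightness at both ends of the block gives
  \<open>x(S\<^sub>i) = p\<^sub>i(S\<^sub>i)\<close>, so the number of larger entries is
  \<open>r\<^sub>i\<close>, whatever the canonical \<open>x\<close>.\<close>

lemma canonical_excess:
  assumes i: "i \<in> {1..canon_len p}" and can: "\<And>k. k \<in> {1..i} \<Longrightarrow> canonical_at p x k"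
  shows "excess p (canon_chain p (i - 1)) (ess_value p i) (canon_part p i) =
    ereal (card {s \<in> canon_part p i. x $ s = real_of_int (ess_value p i)})"
proof -
  have "p (canon_chain p i) = ereal (\<Sum>s\<in>canon_chain p i. x $ s)"
    by (intro canonical_chain_tight can)
  moreover have "p (canon_chain p (i - 1)) = ereal (\<Sum>s\<in>canon_chain p (i - 1). x $ s)"
    using i by (intro canonical_chain_tight can) auto
  moreover have "(\<Sum>s\<in>canon_part p i. x $ s) = (real_of_int (ess_value p i) - 1) * card (canon_part p i)
      + card {s \<in> canon_part p i. x $ s = real_of_int (ess_value p i)}"
    using can[of i] i by (intro sum_two_values) (auto simp: canonical_at_def)
  ultimately show ?thesis
    using canon_chain_sum[OF i, of "\<lambda>s. x $ s"] canon_chain_step[OF i]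
    by (simp add: excess_ereal)
qed

lemma canonical_block_count:
  assumes i: "i \<in> {1..canon_len p}"
    and x: "\<And>k. k \<in> {1..i} \<Longrightarrow> canonical_at p x k" and y: "\<And>k. k \<in> {1..i} \<Longrightarrow> canonical_at p y k"
  shows "card {s \<in> canon_part p i. x $ s = v} = card {s \<in> canon_part p i. y $ s = v}"
proof -
  let ?b = "real_of_int (ess_value p i)" and ?T = "canon_part p i"
  have top: "card {s \<in> ?T. x $ s = ?b} = card {s \<in> ?T. y $ s = ?b}"
    using canonical_excess[OF i x] canonical_excess[OF i y] by simp
  have z: "card {s \<in> ?T. z $ s = v} = (if v = ?b then card {s \<in> ?T. z $ s = ?b}
      else if v = ?b - 1 then card ?T - card {s \<in> ?T. z $ s = ?b} else 0)"
    if "canonical_at p z i" for z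
  proof -
    have two: "z $ s = ?b - 1 \<or> z $ s = ?b" if "s \<in> ?T" for s
      using that \<open>canonical_at p z i\<close> by (auto simp: canonical_at_def)
    have "{s \<in> ?T. z $ s = ?b - 1} = ?T - {s \<in> ?T. z $ s = ?b}" using two by auto
    then have "card {s \<in> ?T. z $ s = ?b - 1} = card ?T - card {s \<in> ?T. z $ s = ?b}"
      by (simp add: card_Diff_subset)
    moreover have "{s \<in> ?T. z $ s = v} = {}" if "v \<noteq> ?b" "v \<noteq> ?b - 1" using that two by auto
    ultimately show ?thesis by auto
  qed
  show ?thesis using z[OF x] z[OF y] top i by simp
qed

text \<open>Stated for initial segments of the chain because a non-canonical vector is compared up
  to its first failing index.\<close>

lemma canonical_chain_count:
  assumes "j \<le> canon_len p"
    and "\<And>k. k \<in> {1..j} \<Longrightarrow> canonical_at p x k" and "\<And>k. k \<in> {1..j} \<Longrightarrow> canonical_at p y k"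
  shows "card {s \<in> canon_chain p j. x $ s = v} = card {s \<in> canon_chain p j. y $ s = v}"
  using assms
proof (induction j)
  case (Suc j)
  then have j: "Suc j \<in> {1..canon_len p}" by simp
  have split: "card {s \<in> canon_chain p (Suc j). z $ s = v}
      = card {s \<in> canon_part p (Suc j). z $ s = v} + card {s \<in> canon_chain p j. z $ s = v}" for z
  proof -
    have "{s \<in> canon_chain p (Suc j). z $ s = v}
        = {s \<in> canon_part p (Suc j). z $ s = v} \<union> {s \<in> canon_chain p j. z $ s = v}"
      using canon_chain_step[OF j] by (auto simp del: canon_chain.simps)
    moreover have "canon_part p (Suc j) \<inter> canon_chain p j = {}" using canon_part_sub[OF j] by auto
    ultimately show ?thesis by (auto intro!: card_Un_disjoint simp del: canon_chain.simps)
  qed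
  have "card {s \<in> canon_chain p j. x $ s = v} = card {s \<in> canon_chain p j. y $ s = v}"
    using Suc by (intro Suc.IH) auto
  moreover have "card {s \<in> canon_part p (Suc j). x $ s = v} = card {s \<in> canon_part p (Suc j). y $ s = v}"
    using Suc.prems by (intro canonical_block_count[OF j])
  ultimately show ?case unfolding split by simp
qed simp

lemma canonical_sorted_eq:
  assumes "\<And>i. i \<in> {1..canon_len p} \<Longrightarrow> canonical_at p x i"
    and "\<And>i. i \<in> {1..canon_len p} \<Longrightarrow> canonical_at p y i"
  shows "sorted_decreasing x = sorted_decreasing y"
  using canonical_chain_count[OF order_refl assms] canon_chain_len[OF p_assms]
  by (intro sorted_decreasing_eqI) simp

section \<open>Canonical vectors precede all other integral vectors of the polyhedron\<close>

lemma canonical_less_noncanonical: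
  assumes x: "x \<in> base_polyhedron p" "x \<in> integral_points"
    and not: "\<not> (\<forall>i\<in>{1..canon_len p}. canonical_at p x i)"
    and m: "\<And>i. i \<in> {1..canon_len p} \<Longrightarrow> canonical_at p m i"
  shows "(sorted_decreasing m, sorted_decreasing x) \<in> lexord {(a, b). a < b}"
proof -
  define bad where "bad i \<longleftrightarrow> i \<in> {1..canon_len p} \<and> \<not> canonical_at p x i" for i
  have "\<exists>i. bad i" using not unfolding bad_def by blast
  then obtain i where "bad i" and least: "\<And>k. k < i \<Longrightarrow> \<not> bad k"
    unfolding exists_least_iff[of bad] by blast
  then have i: "i \<in> {1..canon_len p}" and nc: "\<not> canonical_at p x i"
    and before: "\<And>k. k \<in> {1..i - 1} \<Longrightarrow> canonical_at p x k"
    unfolding bad_def by auto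
  let ?C = "canon_chain p (i - 1)" and ?T = "canon_part p i" and ?b = "real_of_int (ess_value p i)"
  have tight: "p ?C = ereal (\<Sum>s\<in>?C. x $ s)" by (intro canonical_chain_tight before)
  have eqC: "card {s \<in> ?C. m $ s = v} = card {s \<in> ?C. x $ s = v}" for v
    using i by (intro canonical_chain_count m before) auto
  have split: "card {s. z $ s = v} = card {s \<in> ?C. z $ s = v} + card {s \<in> - ?C. z $ s = v}"
    for z :: "real ^ 's" and v
    by (subst card_Un_disjoint[symmetric]) (auto intro: arg_cong[where f = card])
  \<comment> \<open>Outside \<open>?C\<close> only blocks from index \<open>i\<close> on occur, and
    essential values decrease strictly.\<close>
  have m_top: "m $ s \<le> ?b" "m $ s = ?b \<Longrightarrow> s \<in> ?T" if s: "s \<in> - ?C" for s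
  proof -
    obtain k where k: "k \<in> {1..canon_len p}" "s \<in> canon_part p k"
      using canon_part_partition[OF p_assms, of s] by blast
    have "\<not> k \<le> i - 1"
    proof
      assume "k \<le> i - 1"
      then have "s \<in> ?C" unfolding canon_chain_eq[OF p_assms] using k by auto
      then show False using s by simp
    qed
    then have ik: "i \<le> k" by simp
    have mk: "m $ s \<le> real_of_int (ess_value p k)"
      using m[OF k(1)] k(2) unfolding canonical_at_def by force
    have "m $ s < ?b" if "i \<noteq> k"
    proof -
      have "ess_value p k < ess_value p i"
        using that ik i k(1) by (intro ess_value_strict_decreasing) auto
      then show ?thesis using mk by linarith
    qed
    then show "m $ s \<le> ?b" "m $ s = ?b \<Longrightarrow> s \<in> ?T" using mk k(2) by (cases "i = k"; force)+
  qed
  have m_none: "card {s \<in> - ?C. m $ s = v} = 0" if "?b < v" for v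
    using m_top(1) that by force
  \<comment> \<open>Multiplicities on \<open>?C\<close> cancel, so only those outside
    \<open>?C\<close> are compared.\<close>
  have lessI: ?thesis
    if "\<And>v. t < v \<Longrightarrow> card {s \<in> - ?C. m $ s = v} = card {s \<in> - ?C. x $ s = v}"
      "card {s \<in> - ?C. m $ s = t} < card {s \<in> - ?C. x $ s = t}" for t
    by (rule sorted_decreasing_lessI[of t]) (simp_all only: split eqC that add_less_cancel_left)
  show ?thesis
  proof (cases "\<exists>s\<in>- ?C. ?b < x $ s")
    case True
    \<comment> \<open>The largest entry of \<open>x\<close> outside \<open>?C\<close> exceeds
      \<open>?b\<close> and therefore does not occur in \<open>m\<close> there.\<close>
    define t where "t = Max ((\<lambda>s. x $ s) ` (- ?C))"
    have ne: "(\<lambda>s. x $ s) ` (- ?C) \<noteq> {}" using True by blast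
    have le: "x $ s \<le> t" if "s \<in> - ?C" for s using that by (simp add: t_def)
    have bt: "?b < t" using True le by force
    have "t \<in> (\<lambda>s. x $ s) ` (- ?C)" unfolding t_def using ne by (intro Max_in) auto
    then have "card {s \<in> - ?C. x $ s = t} > 0" by (auto simp: card_gt_0_iff)
    moreover have "card {s \<in> - ?C. x $ s = v} = 0" if "t < v" for v using le that by force
    ultimately show ?thesis
      using bt by (intro lessI[of t]) (simp_all only: m_none order.strict_trans[OF bt])
  next
    case False
    then have le: "x $ s \<le> ?b" if "s \<in> - ?C" for s using that by force
    \<comment> \<open>An integral entry below \<open>?b\<close> is at most \<open>?b - 1\<close>.
      Summed over \<open>?T\<close>, this bounds the excess of \<open>x\<close> by its number of
      entries \<open>?b\<close>.\<close>
    have step: "x $ s - (?b - 1) \<le> of_bool (x $ s = ?b)" if "s \<in> - ?C" for s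
    proof -
      obtain k :: int where "x $ s = of_int k"
        using x(2) by (auto simp: integral_points_def elim: Ints_cases)
      then show ?thesis using le[OF that] by (cases "k = ess_value p i") auto
    qed
    let ?r = "card {s \<in> ?T. m $ s = ?b}"
    have TC: "?T \<subseteq> - ?C" by (rule canon_part_sub[OF i])
    have "excess p ?C (ess_value p i) ?T = ereal ?r"
      using i by (intro canonical_excess m) auto
    then have r: "?r \<le> (\<Sum>s\<in>?T. x $ s) - (?b - 1) * card ?T"
      using base_polyhedron_excess_le[OF x(1) tight TC, of "ess_value p i"] by simp
    \<comment> \<open>Otherwise \<open>?r\<close>, the excess of \<open>x\<close> on
      \<open>?T\<close> and its number of entries \<open>?b\<close> there all coincide. Termwise
      equality leaves two values, and equal block sums carry tightness from \<open>m\<close> to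
      \<open>x\<close>, so \<open>x\<close> would be canonical at \<open>i\<close>.\<close>
    have "?r < card {s \<in> - ?C. x $ s = ?b}"
    proof (rule ccontr)
      assume "\<not> ?thesis"
      moreover have "card {s \<in> ?T. x $ s = ?b} \<le> card {s \<in> - ?C. x $ s = ?b}"
        using TC by (intro card_mono) auto
      ultimately have few: "card {s \<in> ?T. x $ s = ?b} \<le> ?r" by linarith
      have sums: "(\<Sum>s\<in>?T. x $ s - (?b - 1)) = (\<Sum>s\<in>?T. x $ s) - (?b - 1) * card ?T"
        "(\<Sum>s\<in>?T. of_bool (x $ s = ?b)) = real (card {s \<in> ?T. x $ s = ?b})"
        by (simp_all add: sum_subtractf Int_def)
      have le_sum: "(\<Sum>s\<in>?T. x $ s - (?b - 1)) \<le> (\<Sum>s\<in>?T. of_bool (x $ s = ?b))"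
        by (rule sum_mono) (rule step[OF subsetD[OF TC]])
      have eq: "(\<Sum>s\<in>?T. x $ s - (?b - 1)) = (\<Sum>s\<in>?T. of_bool (x $ s = ?b))"
        using r few le_sum unfolding sums by linarith
      have "x $ s - (?b - 1) = of_bool (x $ s = ?b)" if "s \<in> ?T" for s
        by (rule sum_mono_inv[OF eq step[OF subsetD[OF TC]] that]) simp_all
      then have two: "\<forall>s\<in>?T. x $ s = ?b - 1 \<or> x $ s = ?b" by (force simp: of_bool_def split: if_splits)
      have "(\<Sum>s\<in>?T. x $ s) = (\<Sum>s\<in>?T. m $ s)"
      proof -
        have "(\<Sum>s\<in>?T. m $ s) = (?b - 1) * card ?T + ?r"
          using m[OF i] by (intro sum_two_values) (auto simp: canonical_at_def)
        then show ?thesis using r few le_sum unfolding sums by linarith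
      qed
      moreover have "p ?C = ereal (\<Sum>s\<in>?C. m $ s)" using i by (intro canonical_chain_tight m) auto
      moreover have "p (canon_chain p i) = ereal (\<Sum>s\<in>canon_chain p i. m $ s)"
        using m[OF i] by (simp add: canonical_at_def)
      ultimately have "p (canon_chain p i) = ereal (\<Sum>s\<in>canon_chain p i. x $ s)"
        using tight by (simp add: canon_chain_sum[OF i])
      then show False using nc two unfolding canonical_at_def by blast
    qed
    moreover have "{s \<in> - ?C. m $ s = ?b} = {s \<in> ?T. m $ s = ?b}" using m_top(2) TC by blast
    moreover have "card {s \<in> - ?C. x $ s = v} = 0" if "?b < v" for v using le that by force
    ultimately show ?thesis by (intro lessI[of ?b]) (simp_all only: m_none)
  qed
qed

section \<open>Canonical vectors of the polyhedron as shifted bases\<close>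

text \<open>The positions of the larger value in each block form a basis: the size is
  \<open>canonical_excess\<close>, and the inequalities are the polyhedron's constraints after
  contracting the preceding chain set.\<close>

lemma canonical_imp_char_vec:
  assumes x: "x \<in> base_polyhedron p" and can: "\<And>i. i \<in> {1..canon_len p} \<Longrightarrow> canonical_at p x i"
  shows "\<exists>L \<in> canon_matroid_bases p. x = char_vec L + canon_shift p"
proof -
  define K where "K i = {s \<in> canon_part p i. x $ s = real_of_int (ess_value p i)}" for i
  have K: "K i \<in> canon_bases p i" if i: "i \<in> {1..canon_len p}" for i
  proof -
    have "excess p (canon_chain p (i - 1)) (ess_value p i) X \<le> ereal (card (K i \<inter> X))"
      if X: "X \<subseteq> canon_part p i" for X
    proof -
      have "K i \<inter> X = {s \<in> X. x $ s = real_of_int (ess_value p i)}" using X by (auto simp: K_def)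
      moreover have "(\<Sum>s\<in>X. x $ s) = (real_of_int (ess_value p i) - 1) * card X
          + card {s \<in> X. x $ s = real_of_int (ess_value p i)}"
        using can[OF i] X by (intro sum_two_values) (auto simp: canonical_at_def)
      moreover have "p (canon_chain p (i - 1)) = ereal (\<Sum>s\<in>canon_chain p (i - 1). x $ s)"
        using i by (intro canonical_chain_tight can) auto
      then have "excess p (canon_chain p (i - 1)) (ess_value p i) X
          \<le> ereal ((\<Sum>s\<in>X. x $ s) - (real_of_int (ess_value p i) - 1) * card X)"
        using X canon_part_sub[OF i] by (intro base_polyhedron_excess_le x) auto
      ultimately show ?thesis by simp
    qed
    moreover have "excess p (canon_chain p (i - 1)) (ess_value p i) (canon_part p i) = ereal (card (K i))"
      unfolding K_def using i by (intro canonical_excess can) auto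
    ultimately show ?thesis unfolding canon_bases_def by (auto simp: K_def)
  qed
  define L where "L = (\<Union>i\<in>{1..canon_len p}. K i)"
  have "L \<in> canon_matroid_bases p"
    unfolding canon_matroid_bases_def direct_sum_bases_def L_def using K by blast
  moreover have "x $ s = (char_vec L + canon_shift p) $ s" for s
  proof -
    obtain i where i: "i \<in> {1..canon_len p}" "s \<in> canon_part p i"
      using canon_part_partition[OF p_assms, of s] by blast
    have "s \<in> L \<longleftrightarrow> x $ s = real_of_int (ess_value p i)"
    proof
      assume "s \<in> L"
      then obtain k where k: "k \<in> {1..canon_len p}" "s \<in> K k" unfolding L_def by blast
      then have "k = i" using i canon_part_partition[OF p_assms, of s] unfolding K_def by blast
      then show "x $ s = real_of_int (ess_value p i)" using k by (simp add: K_def)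
    qed (use i in \<open>auto simp: L_def K_def\<close>)
    then show ?thesis
      using can[OF i(1)] i by (auto simp: canonical_at_def char_vec_def canon_shift_nth indicator_def)
  qed
  ultimately show ?thesis by (auto simp: vec_eq_iff)
qed

text \<open>The sizes of the block bases give tightness along the chain; their inequalities,
  together with supermodularity, give the constraints for arbitrary sets.\<close>

lemma char_vec_imp_canonical:
  assumes L: "L \<in> canon_matroid_bases p" and x: "x = char_vec L + canon_shift p"
  shows "x \<in> base_polyhedron p \<inter> integral_points"
    and "\<And>i. i \<in> {1..canon_len p} \<Longrightarrow> canonical_at p x i"
proof -
  obtain K where LK: "L = (\<Union>i\<in>{1..canon_len p}. K i)"
    and K: "\<And>i. i \<in> {1..canon_len p} \<Longrightarrow> K i \<in> canon_bases p i"
    using L unfolding canon_matroid_bases_def direct_sum_bases_def by auto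
  have Ksub: "K i \<subseteq> canon_part p i" if "i \<in> {1..canon_len p}" for i
    using K[OF that] unfolding canon_bases_def by blast
  have x_nth: "x $ s = (real_of_int (ess_value p i) - 1) + of_bool (s \<in> K i)"
    if i: "i \<in> {1..canon_len p}" "s \<in> canon_part p i" for i s
  proof -
    have "s \<in> L \<longleftrightarrow> s \<in> K i"
    proof
      assume "s \<in> L"
      then obtain k where k: "k \<in> {1..canon_len p}" "s \<in> K k" unfolding LK by blast
      then have "k = i" using i canon_part_partition[OF p_assms, of s] Ksub by blast
      then show "s \<in> K i" using k by simp
    qed (use i in \<open>auto simp: LK\<close>)
    then show ?thesis using i by (simp add: x char_vec_def canon_shift_nth indicator_def)
  qed
  have x_sum: "(\<Sum>s\<in>X. x $ s) = (real_of_int (ess_value p i) - 1) * card X + card (K i \<inter> X)"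
    if "i \<in> {1..canon_len p}" "X \<subseteq> canon_part p i" for i X
  proof -
    have "(\<Sum>s\<in>X. x $ s) = (\<Sum>s\<in>X. (real_of_int (ess_value p i) - 1) + of_bool (s \<in> K i))"
      using that by (intro sum.cong) (auto simp: x_nth)
    then show ?thesis by (simp add: sum.distrib Int_commute)
  qed
  have tight: "p (canon_chain p j) = ereal (\<Sum>s\<in>canon_chain p j. x $ s)" if "j \<le> canon_len p" for j
    using that
  proof (induction j)
    case 0
    then show ?case by (simp add: empty zero_ereal_def)
  next
    case (Suc j)
    then have j: "Suc j \<in> {1..canon_len p}" by simp
    have c: "p (canon_chain p j) = ereal (\<Sum>s\<in>canon_chain p j. x $ s)" using Suc by simp
    obtain d where d: "p (canon_chain p (Suc j)) = ereal d"
      using p_canon_chain_finite[OF p_assms, of "Suc j"] p_not_PInf[OF p_assms, of "canon_chain p (Suc j)"]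
      by (cases "p (canon_chain p (Suc j))") auto
    have "ereal (card (K (Suc j))) = excess p (canon_chain p j) (ess_value p (Suc j)) (canon_part p (Suc j))"
      using K[OF j] unfolding canon_bases_def by simp
    also have "\<dots> = ereal (d - (\<Sum>s\<in>canon_chain p j. x $ s)
        - (real_of_int (ess_value p (Suc j)) - 1) * card (canon_part p (Suc j)))"
      using c d canon_chain_step[OF j] by (intro excess_ereal) auto
    finally have "d = (\<Sum>s\<in>canon_part p (Suc j). x $ s) + (\<Sum>s\<in>canon_chain p j. x $ s)"
      using x_sum[OF j order_refl] Ksub[OF j] by (simp add: Int_absorb2)
    then show ?case using d canon_chain_sum[OF j, of "\<lambda>s. x $ s"] by simp
  qed
  \<comment> \<open>Induction runs over traces of \<open>Z\<close> on the chain; at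
    \<open>canon_len p\<close> the trace is \<open>Z\<close> itself.\<close>
  have below: "p (Z \<inter> canon_chain p j) \<le> ereal (\<Sum>s\<in>Z \<inter> canon_chain p j. x $ s)"
    if "j \<le> canon_len p" for j Z
    using that
  proof (induction j)
    case 0
    then show ?case by (simp add: empty zero_ereal_def)
  next
    case (Suc j)
    then have j: "Suc j \<in> {1..canon_len p}" by simp
    let ?C = "canon_chain p j" and ?D = "canon_chain p (Suc j)" and ?X = "Z \<inter> canon_part p (Suc j)"
    have step: "?D = canon_part p (Suc j) \<union> ?C" and dis: "canon_part p (Suc j) \<subseteq> - ?C"
      using canon_chain_step[OF j] canon_part_sub[OF j] by auto
    \<comment> \<open>Uncrossing \<open>Z \<inter> C\<^sub>j\<^sub>+\<^sub>1\<close> with \<open>C\<^sub>j\<close>.\<close>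
    have sets: "(Z \<inter> ?D) \<inter> ?C = Z \<inter> ?C" "(Z \<inter> ?D) \<union> ?C = ?X \<union> ?C" "Z \<inter> ?D = ?X \<union> (Z \<inter> ?C)"
      unfolding step by blast+
    have c: "p ?C = ereal (\<Sum>s\<in>?C. x $ s)" using Suc.prems by (intro tight) simp
    have "excess p ?C (ess_value p (Suc j)) ?X \<le> ereal (card (K (Suc j) \<inter> ?X))"
      using K[OF j] unfolding canon_bases_def by simp
    then have "p (?X \<union> ?C) \<le> ereal ((\<Sum>s\<in>?C. x $ s) + (\<Sum>s\<in>?X. x $ s))"
      using c x_sum[OF j, of ?X] by (simp add: excess_le_iff add.assoc)
    moreover have "p (Z \<inter> ?D) + p ?C \<le> p (Z \<inter> ?C) + p (?X \<union> ?C)"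
      using super sets(1,2) unfolding supermodular_def by metis
    moreover have "p (Z \<inter> ?C) \<le> ereal (\<Sum>s\<in>Z \<inter> ?C. x $ s)" using Suc by simp
    moreover have "(\<Sum>s\<in>Z \<inter> ?D. x $ s) = (\<Sum>s\<in>?X. x $ s) + (\<Sum>s\<in>Z \<inter> ?C. x $ s)"
      unfolding sets(3) using dis by (intro sum.union_disjoint) auto
    ultimately show ?case unfolding c
      by (cases "p (Z \<inter> ?D)"; cases "p (Z \<inter> ?C)"; cases "p (?X \<union> ?C)") auto
  qed
  have "x \<in> base_polyhedron p"
    using tight[OF order_refl] below[OF order_refl] canon_chain_len[OF p_assms]
    by (simp add: base_polyhedron_def)
  moreover have "x \<in> integral_points"
    by (simp add: integral_points_def x char_vec_def canon_shift_def indicator_def)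
  ultimately show "x \<in> base_polyhedron p \<inter> integral_points" by blast
  show "canonical_at p x i" if i: "i \<in> {1..canon_len p}" for i
    using x_nth[OF i] tight i by (auto simp: canonical_at_def)
qed

text \<open>Supplies the canonical vector against which a decreasingly minimal one is
  measured.\<close>

lemma canon_matroid_bases_nonempty: "canon_matroid_bases p \<noteq> {}"
proof -
  define K where "K i = (SOME L. L \<in> canon_bases p i)" for i
  have "K i \<in> canon_bases p i" if "i \<in> {1..canon_len p}" for i
    using canon_bases_matroid[OF that] unfolding K_def matroid_basis_family_def some_in_eq by simp
  then show ?thesis unfolding canon_matroid_bases_def direct_sum_bases_def by blast
qed

section \<open>The decreasingly minimal elements\<close>

text \<open>Canonical vectors tie with each other and strictly precede the rest, so asymmetry of
  \<open>lexord\<close> forces a minimal vector to be canonical.\<close>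

lemma dec_min_iff:
  "dec_min (base_polyhedron p \<inter> integral_points) x \<longleftrightarrow>
   (\<exists>L \<in> canon_matroid_bases p. x = char_vec L + canon_shift p)" (is "dec_min ?Q x \<longleftrightarrow> _")
proof
  assume x: "dec_min ?Q x"
  then have xQ: "x \<in> base_polyhedron p" "x \<in> integral_points" by (auto simp: dec_min_def)
  obtain L where "L \<in> canon_matroid_bases p" using canon_matroid_bases_nonempty by blast
  note m = char_vec_imp_canonical[OF this refl]
  let ?m = "char_vec L + canon_shift p"
  have le: "lex_le (sorted_decreasing x) (sorted_decreasing ?m)"
    using x m(1) unfolding dec_min_def by blast
  have asym: "asym {(a :: real, b). a < b}" by auto
  have "canonical_at p x i" if "i \<in> {1..canon_len p}" for i
  proof (rule ccontr)
    assume "\<not> canonical_at p x i"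
    then have "(sorted_decreasing ?m, sorted_decreasing x) \<in> lexord {(a, b). a < b}"
      using that by (intro canonical_less_noncanonical xQ m) auto
    then show False
      using le lexord_asymmetric[OF asym] unfolding lex_le_def by metis
  qed
  then show "\<exists>L \<in> canon_matroid_bases p. x = char_vec L + canon_shift p"
    using canonical_imp_char_vec[OF xQ(1)] by blast
next
  assume "\<exists>L \<in> canon_matroid_bases p. x = char_vec L + canon_shift p"
  then obtain L where "L \<in> canon_matroid_bases p" "x = char_vec L + canon_shift p" by blast
  note x = char_vec_imp_canonical[OF this]
  have "lex_le (sorted_decreasing x) (sorted_decreasing y)" if "y \<in> ?Q" for y
  proof (cases "\<forall>i\<in>{1..canon_len p}. canonical_at p y i")
    case True
    then show ?thesis using canonical_sorted_eq[OF x(2), of y] by (simp add: lex_le_def)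
  next
    case False
    then show ?thesis
      using canonical_less_noncanonical[OF _ _ False x(2)] that by (simp add: lex_le_def)
  qed
  then show "dec_min ?Q x" using x(1) by (simp add: dec_min_def)
qed

text \<open>The shift is integral, so integral points of the translate come from integral points of
  the hull, which are characteristic vectors of bases.\<close>

lemma dec_min_set_eq:
  "{m. dec_min (base_polyhedron p \<inter> integral_points) m} =
   (+) (canon_shift p) ` matroid_base_polyhedron (canon_matroid_bases p) \<inter> integral_points"
  (is "?D = ?H")
proof
  show "?D \<subseteq> ?H"
  proof
    fix m assume "m \<in> ?D"
    then obtain L where L: "L \<in> canon_matroid_bases p" "m = canon_shift p + char_vec L"
      by (auto simp: dec_min_iff add.commute)
    then have "m \<in> integral_points"
      using char_vec_imp_canonical(1)[OF L(1), of m] by (simp add: add.commute)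
    then show "m \<in> ?H" using L unfolding matroid_base_polyhedron_def by (auto intro: hull_inc)
  qed
  show "?H \<subseteq> ?D"
  proof
    fix m assume "m \<in> ?H"
    then obtain y where y: "m = canon_shift p + y" "m \<in> integral_points"
      "y \<in> convex hull (char_vec ` canon_matroid_bases p)"
      unfolding matroid_base_polyhedron_def by blast
    have "y $ s = m $ s - canon_shift p $ s" for s using y(1) by simp
    then have "y \<in> integral_points"
      using y(2) by (auto simp: integral_points_def canon_shift_def intro!: Ints_diff)
    then obtain L where "L \<in> canon_matroid_bases p" "y = char_vec L"
      using integral_in_hull_char_vec[OF y(3)] by blast
    then show "m \<in> ?D" using y(1) by (auto simp: dec_min_iff add.commute)
  qed
qed

end

theorem theorem5p7:
  fixes p :: "'s::finite set \<Rightarrow> ereal"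
  assumes "int_or_minf_valued p"
    and "supermodular p"
    and "p {} = 0"
    and "p UNIV \<noteq> -\<infinity>"
  shows "(\<forall>i\<in>{1..canon_len p}. matroid_basis_family (canon_part p i) (canon_bases p i)) \<and>
    (\<forall>m \<in> base_polyhedron p \<inter> integral_points.
       dec_min (base_polyhedron p \<inter> integral_points) m \<longleftrightarrow>
       (\<exists>L \<in> canon_matroid_bases p. m = char_vec L + canon_shift p)) \<and>
    {m. dec_min (base_polyhedron p \<inter> integral_points) m} =
      (+) (canon_shift p) ` matroid_base_polyhedron (canon_matroid_bases p) \<inter> integral_points"
  by (intro conjI ballI canon_bases_matroid[OF assms] dec_min_iff[OF assms] dec_min_set_eq[OF assms])

end
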